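(* If $X$ is a consonant topological space, then $\mathbf{A}(\mathbf{K}(X))$ and $\mathbf{K}(\mathbf{A}(X))$ are homeomorphic, via the map $\sigma\colon\mathbf{A}(\mathbf{K}(X))\to\mathbf{K}(\mathbf{A}(X))$ and its inverse $\tau\colon\mathbf{K}(\mathbf{A}(X))\to\mathbf{A}(\mathbf{K}(X))$.
   Context: For a topological space $Y$: $\mathbf{A}(Y)$ is the set of all closed subsets of $Y$ with the lower Vietoris topology, generated by the sets $\Diamond U=\{A\in\mathbf{A}(Y)\mid A\cap U\neq\emptyset\}$ for $U\subseteq Y$ open. $\mathbf{K}(Y)$ is the set of all compact saturated subsets of $Y$ with the upper Vietoris topology, generated by the sets $\Box U=\{K\in\mathbf{K}(Y)\mid K\subseteq U\}$ for $U\subseteq Y$ open. (Compact: every open cover has a finite subcover. Saturated: equal to the intersection of all its open neighborhoods.) The maps $\sigma$ and $\tau$ (which are well-defined for every topological space $X$) are $$\sigma(\mathcal{A})=\{A\in\mathbf{A}(X)\mid(\forall K\in\mathcal{A})\,A\cap K\neq\emptyset\},\qquad \tau(\mathcal{K})=\{K\in\mathbf{K}(X)\mid(\forall A\in\mathcal{K})\,A\cap K\neq\emptyset\}.$$ $\mathbf{O}(X)$ is the lattice of open subsets of $X$ ordered by inclusion, equipped with the Scott topology. $X$ is consonant if for every Scott-open $\mathcal{H}\subseteq\mathbf{O}(X)$ and every $U\in\mathcal{H}$ there is $K\in\mathbf{K}(X)$ with $U\in\triangledown K\subseteq\mathcal{H}$, where $\triangledown K=\{V\in\mathbf{O}(X)\mid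 K\subseteq V\}$. *)

theory Defs
  imports "HOL-Analysis.Abstract_Topology"
begin

definition compact_saturated_in :: "'a topology \<Rightarrow> 'a set \<Rightarrow> bool" where
  "compact_saturated_in Y K \<longleftrightarrow>
     compactin Y K \<and> K = \<Inter> {U. openin Y U \<and> K \<subseteq> U}"

text \<open>The carrier is added to the subbasis because \<open>topology_generated_by\<close> takes the union of the
  subbasis as underlying space, and the closed set \<open>{}\<close> meets no open set. The nullary
  intersection is thus the whole hyperspace, as for any subbasis.\<close>

definition lower_vietoris :: "'a topology \<Rightarrow> 'a set topology" where
  "lower_vietoris Y = topology_generated_by
     (insert {A. closedin Y A} {{A. closedin Y A \<and> A \<inter> U \<noteq> {}} | U. openin Y U})"

definition upper_vietoris :: "'a topology \<Rightarrow> 'a set topology" where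
  "upper_vietoris Y = topology_generated_by
     (insert {K. compact_saturated_in Y K} {{K. compact_saturated_in Y K \<and> K \<subseteq> U} | U. openin Y U})"

lemma topspace_lower_vietoris: "topspace (lower_vietoris Y) = {A. closedin Y A}"
  by (auto simp: lower_vietoris_def)

lemma topspace_upper_vietoris: "topspace (upper_vietoris Y) = {K. compact_saturated_in Y K}"
  by (auto simp: upper_vietoris_def)

definition sigma_map :: "'a topology \<Rightarrow> 'a set set \<Rightarrow> 'a set set" where
  "sigma_map X \<A> = {A. closedin X A \<and> (\<forall>K\<in>\<A>. A \<inter> K \<noteq> {})}"

definition tau_map :: "'a topology \<Rightarrow> 'a set set \<Rightarrow> 'a set set" where
  "tau_map X \<K> = {K. compact_saturated_in X K \<and> (\<forall>A\<in>\<K>. A \<inter> K \<noteq> {})}"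

text \<open>Scott-open subsets of the lattice of open sets: upper sets inaccessible by directed suprema,
  the supremum of a family of open sets being its union.\<close>

definition scott_open :: "'a topology \<Rightarrow> 'a set set \<Rightarrow> bool" where
  "scott_open X \<H> \<longleftrightarrow>
     \<H> \<subseteq> {U. openin X U} \<and>
     (\<forall>U V. U \<in> \<H> \<and> openin X V \<and> U \<subseteq> V \<longrightarrow> V \<in> \<H>) \<and>
     (\<forall>\<D>. \<D> \<subseteq> {U. openin X U} \<and> \<D> \<noteq> {} \<and>
          (\<forall>U\<in>\<D>. \<forall>V\<in>\<D>. \<exists>W\<in>\<D>. U \<subseteq> W \<and> V \<subseteq> W) \<and> \<Union>\<D> \<in> \<H>
        \<longrightarrow> \<D> \<inter> \<H> \<noteq> {})"

definition open_supersets :: "'a topology \<Rightarrow> 'a set \<Rightarrow> 'a set set" where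
  "open_supersets X K = {V. openin X V \<and> K \<subseteq> V}"

definition consonant :: "'a topology \<Rightarrow> bool" where
  "consonant X \<longleftrightarrow>
     (\<forall>\<H>. scott_open X \<H> \<longrightarrow>
        (\<forall>U\<in>\<H>. \<exists>K. compact_saturated_in X K \<and>
           U \<in> open_supersets X K \<and> open_supersets X K \<subseteq> \<H>))"

end

theory Submission
  imports Defs "HOL-Analysis.Function_Topology"
begin

text \<open>For open \<open>U\<close>, the complement of \<open>U\<close> lies outside \<open>\<sigma>(\<A>)\<close> iff some member of \<open>\<A>\<close> is contained in
  \<open>U\<close>, and it lies outside a saturated \<open>\<K>\<close> iff every member of \<open>\<K>\<close> meets \<open>U\<close>. With Alexander's subbase
  lemma the first fact gives compactness of \<open>\<sigma>(\<A>)\<close>, and the two together identify the subbasic open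
  sets on both sides. The open sets whose complement is not in a compact saturated \<open>\<K>\<close> form a
  Scott-open family; consonance applied to it produces, for each closed \<open>A \<notin> \<K>\<close>, a member of
  \<open>\<tau>(\<K>)\<close> disjoint from \<open>A\<close>, so that \<open>\<sigma>(\<tau>(\<K>)) = \<K>\<close>.\<close>

section \<open>Compactness tested on a subbasis\<close>

text \<open>This matches the topology in \<open>Alexander_subbase_alt\<close>, built from finite
  intersections relative to \<open>S\<close>, with the subspace topology that
  \<open>compactin\<close> refers to. The two differ only in the treatment of the empty
  intersection, which here is \<open>S\<close> itself.\<close>

lemma subtopology_topology_generated_by:
  assumes "S \<subseteq> \<Union>\<B>"
  shows "topology (arbitrary union_of (finite intersection_of (\<lambda>x. x \<in> \<B>) relative_to S))
         = subtopology (topology_generated_by \<B>) S" (is "?Z = ?Y")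
proof -
  have Z: "openin ?Z = arbitrary union_of (finite intersection_of (\<lambda>x. x \<in> \<B>) relative_to S)"
    by (rule topology_inverse'[OF istopology_subbase])
  have "openin ?Y W" if "openin ?Z W" for W
  proof -
    have "openin ?Y F" if F: "(finite intersection_of (\<lambda>x. x \<in> \<B>) relative_to S) F" for F
    proof -
      obtain \<G> where \<G>: "finite \<G>" "\<G> \<subseteq> \<B>" "F = S \<inter> \<Inter>\<G>"
        using F by (auto simp: relative_to_def intersection_of_def)
      show ?thesis
      proof (cases "\<G> = {}")
        \<comment> \<open>The relative empty intersection is \<open>S\<close>, which is open in its
          own subspace because \<open>S\<close> lies in the union of the subbasis.\<close>
        case True
        then show ?thesis
          using \<G> assms by (metis Inf_empty inf_top.right_neutral openin_subtopology_refl
              topology_generated_by_topspace)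
      next
        case False
        then have "openin (topology_generated_by \<B>) (\<Inter>\<G>)"
          using \<G> by (intro openin_Inter) (auto intro: topology_generated_by_Basis)
        then show ?thesis
          using \<G> by (auto simp: openin_subtopology_Int2)
      qed
    qed
    moreover have "(arbitrary union_of (finite intersection_of (\<lambda>x. x \<in> \<B>) relative_to S)) W"
      using that by (simp only: Z)
    then obtain \<U> where "\<U> \<subseteq> Collect (finite intersection_of (\<lambda>x. x \<in> \<B>) relative_to S)"
      "W = \<Union>\<U>"
      by (auto simp: union_of_def)
    ultimately show ?thesis
      by auto
  qed
  moreover have "openin ?Z W" if W: "openin ?Y W" for W
  proof -
    obtain V where V: "generate_topology_on \<B> V" "W = V \<inter> S"
      using W by (auto simp: openin_subtopology openin_topology_generated_by_iff)
    \<comment> \<open>Taking the trace on \<open>S\<close> commutes with unions and binary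
      intersections, so the induction generating \<open>V\<close> also generates its trace.\<close>
    from V(1) have "openin ?Z (V \<inter> S)"
    proof induction
      case Empty
      then show ?case by simp
    next
      case (Int a b)
      then have "openin ?Z ((a \<inter> S) \<inter> (b \<inter> S))"
        by (intro openin_Int[of _ "a \<inter> S"])
      then show ?case
        by (simp add: Int_ac)
    next
      case (UN K)
      then have "openin ?Z (\<Union>((\<lambda>k. k \<inter> S) ` K))"
        by (intro openin_Union) auto
      then show ?case
        by (simp only: Int_Union2)
    next
      case (Basis s)
      then have "(finite intersection_of (\<lambda>x. x \<in> \<B>) relative_to S) (S \<inter> s)"
        by (intro relative_to_inc) (simp add: finite_intersection_of_inc)
      then show ?case
        unfolding Z by (simp add: arbitrary_union_of_inc Int_commute)
    qed
    then show ?thesis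
      using V by simp
  qed
  ultimately show ?thesis
    unfolding topology_eq by blast
qed

lemma compactin_topology_generated_by:
  assumes S: "S \<subseteq> \<Union>\<B>"
    and fin: "\<And>\<C>. \<lbrakk>\<C> \<subseteq> \<B>; S \<subseteq> \<Union>\<C>\<rbrakk> \<Longrightarrow> \<exists>\<C>'. finite \<C>' \<and> \<C>' \<subseteq> \<C> \<and> S \<subseteq> \<Union>\<C>'"
  shows "compactin (topology_generated_by \<B>) S"
proof -
  have "compact_space (subtopology (topology_generated_by \<B>) S)"
    using Alexander_subbase_alt[OF S fin subtopology_topology_generated_by[OF S]] by blast
  then show ?thesis
    using S by (simp add: compactin_subspace)
qed

section \<open>Basic neighbourhoods in the two Vietoris topologies\<close>

lemma compact_saturated_in_subset_topspace:
  "compact_saturated_in Y K \<Longrightarrow> K \<subseteq> topspace Y"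
  by (simp add: compact_saturated_in_def compactin_subset_topspace)

lemma openin_lower_vietoris_hit:
  "openin Y U \<Longrightarrow> openin (lower_vietoris Y) {A. closedin Y A \<and> A \<inter> U \<noteq> {}}"
  unfolding lower_vietoris_def by (rule topology_generated_by_Basis) blast

lemma openin_upper_vietoris_subset:
  "openin Y U \<Longrightarrow> openin (upper_vietoris Y) {K. compact_saturated_in Y K \<and> K \<subseteq> U}"
  unfolding upper_vietoris_def by (rule topology_generated_by_Basis) blast

text \<open>A single box suffices: the boxes of \<open>U\<close> and \<open>V\<close> intersect in
  the box of \<open>U \<inter> V\<close>, and the whole hyperspace is the box of
  \<open>topspace Y\<close>.\<close>

lemma openin_upper_vietorisE:
  assumes "openin (upper_vietoris Y) W" "K \<in> W"
  obtains U where "openin Y U" "K \<subseteq> U" "{L. compact_saturated_in Y L \<and> L \<subseteq> U} \<subseteq> W"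
proof -
  have "generate_topology_on (insert {K. compact_saturated_in Y K}
      {{K. compact_saturated_in Y K \<and> K \<subseteq> U} | U. openin Y U}) W"
    using assms(1) by (simp add: upper_vietoris_def openin_topology_generated_by_iff)
  then have "\<exists>U. openin Y U \<and> K \<subseteq> U \<and> {L. compact_saturated_in Y L \<and> L \<subseteq> U} \<subseteq> W"
    using assms(2)
  proof (induction arbitrary: K)
    case Empty
    then show ?case by simp
  next
    case (Int a b)
    then have "K \<in> a" "K \<in> b" by auto
    from Int.IH(1)[OF this(1)] Int.IH(2)[OF this(2)] obtain U V where
      "openin Y U" "K \<subseteq> U" "{L. compact_saturated_in Y L \<and> L \<subseteq> U} \<subseteq> a"
      "openin Y V" "K \<subseteq> V" "{L. compact_saturated_in Y L \<and> L \<subseteq> V} \<subseteq> b"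
      by blast
    then show ?case
      by (intro exI[of _ "U \<inter> V"]) auto
  next
    case (UN \<W>)
    then obtain w where w: "K \<in> w" "w \<in> \<W>" by blast
    from UN.IH[OF w(2,1)] w(2) show ?case by blast
  next
    case (Basis s)
    then show ?case
      using compact_saturated_in_subset_topspace[of Y] by (auto intro: openin_topspace)
  qed
  then show ?thesis using that by blast
qed

text \<open>Hitting \<open>U\<close> and hitting \<open>V\<close> do not combine into hitting one
  open set, so a neighbourhood carries a finite family of conditions. The empty family accounts for
  the whole hyperspace.\<close>

lemma openin_lower_vietorisE:
  assumes "openin (lower_vietoris Y) W" "A \<in> W"
  obtains \<F> where "finite \<F>" "\<And>U. U \<in> \<F> \<Longrightarrow> openin Y U" "\<And>U. U \<in> \<F> \<Longrightarrow> A \<inter> U \<noteq> {}"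
    "{B. closedin Y B \<and> (\<forall>U\<in>\<F>. B \<inter> U \<noteq> {})} \<subseteq> W"
proof -
  have "generate_topology_on (insert {A. closedin Y A}
      {{A. closedin Y A \<and> A \<inter> U \<noteq> {}} | U. openin Y U}) W"
    using assms(1) by (simp add: lower_vietoris_def openin_topology_generated_by_iff)
  then have "\<exists>\<F>. finite \<F> \<and> (\<forall>U\<in>\<F>. openin Y U \<and> A \<inter> U \<noteq> {}) \<and>
      {B. closedin Y B \<and> (\<forall>U\<in>\<F>. B \<inter> U \<noteq> {})} \<subseteq> W"
    using assms(2)
  proof (induction arbitrary: A)
    case Empty
    then show ?case by simp
  next
    case (Int a b)
    then have "A \<in> a" "A \<in> b" by auto
    from Int.IH(1)[OF this(1)] Int.IH(2)[OF this(2)] obtain \<F> \<G> where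
      "finite \<F>" "\<forall>U\<in>\<F>. openin Y U \<and> A \<inter> U \<noteq> {}" "{B. closedin Y B \<and> (\<forall>U\<in>\<F>. B \<inter> U \<noteq> {})} \<subseteq> a"
      "finite \<G>" "\<forall>U\<in>\<G>. openin Y U \<and> A \<inter> U \<noteq> {}" "{B. closedin Y B \<and> (\<forall>U\<in>\<G>. B \<inter> U \<noteq> {})} \<subseteq> b"
      by (elim exE conjE) (rule that)
    then show ?case
      by (intro exI[of _ "\<F> \<union> \<G>"]) (simp add: ball_Un subset_iff)
  next
    case (UN \<W>)
    then obtain w where w: "A \<in> w" "w \<in> \<W>" by blast
    from UN.IH[OF w(2,1)] Union_upper[OF w(2)] show ?case
      by (elim exE conjE) (intro exI conjI; (rule subset_trans)?; assumption)
  next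
    case (Basis s)
    then consider "s = {A. closedin Y A}"
      | U where "openin Y U" "s = {A. closedin Y A \<and> A \<inter> U \<noteq> {}}"
      by blast
    then show ?case
    proof cases
      case 1
      then show ?thesis by (intro exI[of _ "{}"]) auto
    next
      case 2
      then show ?thesis using Basis by (intro exI[of _ "{U}"]) auto
    qed
  qed
  then show ?thesis by (elim exE conjE) (rule that; simp)
qed

text \<open>Distributivity: a finite union of finite intersections of hit sets is a finite intersection of
  hit sets, because the sets hitting \<open>U\<close> or \<open>V\<close> are those hitting \<open>U \<union> V\<close>.\<close>

lemma finite_Union_Inter_hit:
  assumes "finite \<Phi>" "\<And>\<F>. \<F> \<in> \<Phi> \<Longrightarrow> finite \<F> \<and> (\<forall>U\<in>\<F>. openin Y U)"
  shows "\<exists>\<G>. finite \<G> \<and> (\<forall>U\<in>\<G>. openin Y U) \<and>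
    (\<forall>A. (\<exists>\<F>\<in>\<Phi>. \<forall>U\<in>\<F>. A \<inter> U \<noteq> {}) \<longleftrightarrow> (\<forall>U\<in>\<G>. A \<inter> U \<noteq> {}))"
  using assms
proof (induction \<Phi>)
  case empty
  \<comment> \<open>The empty disjunction is false, and so is the condition of hitting the empty
    set.\<close>
  then show ?case by (intro exI[of _ "{{}}"]) auto
next
  case (insert \<F> \<Phi>)
  have "\<exists>\<G>. finite \<G> \<and> (\<forall>U\<in>\<G>. openin Y U) \<and>
    (\<forall>A. (\<exists>\<F>\<in>\<Phi>. \<forall>U\<in>\<F>. A \<inter> U \<noteq> {}) \<longleftrightarrow> (\<forall>U\<in>\<G>. A \<inter> U \<noteq> {}))"
    by (intro insert.IH) (rule insert.prems, rule insertI2)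
  then obtain \<G> where \<G>: "finite \<G>" "\<forall>U\<in>\<G>. openin Y U"
    "\<And>A. (\<exists>\<F>\<in>\<Phi>. \<forall>U\<in>\<F>. A \<inter> U \<noteq> {}) \<longleftrightarrow> (\<forall>U\<in>\<G>. A \<inter> U \<noteq> {})"
    by (elim exE conjE) (rule that; simp)
  \<comment> \<open>If \<open>A\<close> misses some \<open>U\<close> in \<open>\<F>\<close> and some
    \<open>V\<close> in \<open>\<G>\<close>, it misses \<open>U \<union> V\<close>; hence hitting
    all these unions forces \<open>A\<close> to hit all of \<open>\<F>\<close> or all of
    \<open>\<G>\<close>.\<close>
  let ?H = "(\<lambda>(U, V). U \<union> V) ` (\<F> \<times> \<G>)"
  have "(\<exists>\<F>'\<in>insert \<F> \<Phi>. \<forall>U\<in>\<F>'. A \<inter> U \<noteq> {}) \<longleftrightarrow> (\<forall>U\<in>?H. A \<inter> U \<noteq> {})" for A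
  proof -
    have "(\<forall>U\<in>?H. A \<inter> U \<noteq> {}) \<longleftrightarrow> (\<forall>U\<in>\<F>. A \<inter> U \<noteq> {}) \<or> (\<forall>V\<in>\<G>. A \<inter> V \<noteq> {})"
      by (simp add: Int_Un_distrib) blast
    then show ?thesis
      using \<G>(3)[of A] by simp
  qed
  moreover have "finite ?H" "\<forall>U\<in>?H. openin Y U"
    using insert.prems \<G>(1,2) by auto
  ultimately show ?case by (intro exI[of _ ?H] conjI allI)
qed

section \<open>Compact and saturated subsets of the lower Vietoris space\<close>

text \<open>Compactness covers \<open>\<K>\<close> by finitely many basic open sets inside
  \<open>W\<close>, and distributivity rewrites their union as one finite intersection of hit sets.
  Continuity of \<open>sigma_map\<close> rests on this interpolation.\<close>

lemma compactin_lower_vietoris_basis: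
  assumes "compactin (lower_vietoris Y) \<K>" "openin (lower_vietoris Y) W" "\<K> \<subseteq> W"
  obtains \<G> where "finite \<G>" "\<And>U. U \<in> \<G> \<Longrightarrow> openin Y U"
    "\<And>A U. \<lbrakk>A \<in> \<K>; U \<in> \<G>\<rbrakk> \<Longrightarrow> A \<inter> U \<noteq> {}"
    "{A. closedin Y A \<and> (\<forall>U\<in>\<G>. A \<inter> U \<noteq> {})} \<subseteq> W"
proof -
  define N where "N \<F> = {A. closedin Y A \<and> (\<forall>U\<in>\<F>. A \<inter> U \<noteq> {})}" for \<F>
  define \<Psi> where "\<Psi> = {\<F>. finite \<F> \<and> (\<forall>U\<in>\<F>. openin Y U) \<and> N \<F> \<subseteq> W}"
  have opN: "openin (lower_vietoris Y) (N \<F>)" if "\<F> \<in> \<Psi>" for \<F>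
  proof -
    have "finite \<F>" "\<forall>U\<in>\<F>. openin Y U"
      using that by (auto simp: \<Psi>_def)
    then show ?thesis
    proof (induction \<F>)
      case empty
      then show ?case
        using openin_topspace[of "lower_vietoris Y"] by (simp add: N_def topspace_lower_vietoris)
    next
      case (insert U \<F>)
      have "N (insert U \<F>) = {A. closedin Y A \<and> A \<inter> U \<noteq> {}} \<inter> N \<F>"
        by (auto simp: N_def)
      then show ?case
        using insert by (simp add: openin_lower_vietoris_hit openin_Int)
    qed
  qed
  have sub: "\<K> \<subseteq> \<Union>(N ` \<Psi>)"
  proof
    fix A assume A: "A \<in> \<K>"
    then have "closedin Y A"
      using assms(1) compactin_subset_topspace topspace_lower_vietoris by fastforce
    moreover obtain \<F> where "finite \<F>" "\<And>U. U \<in> \<F> \<Longrightarrow> openin Y U" "\<And>U. U \<in> \<F> \<Longrightarrow> A \<inter> U \<noteq> {}"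
      "N \<F> \<subseteq> W"
      using openin_lower_vietorisE[OF assms(2), of A] A assms(3) unfolding N_def by blast
    ultimately show "A \<in> \<Union>(N ` \<Psi>)"
      by (auto simp: \<Psi>_def N_def)
  qed
  obtain \<C> where \<C>: "finite \<C>" "\<C> \<subseteq> N ` \<Psi>" "\<K> \<subseteq> \<Union>\<C>"
    using compactinD[OF assms(1) _ sub] opN by blast
  \<comment> \<open>Distributivity acts on the families that index the subcover, so finitely many of
    these are chosen.\<close>
  then obtain \<Phi> where \<Phi>: "finite \<Phi>" "\<Phi> \<subseteq> \<Psi>" "\<C> = N ` \<Phi>"
    by (meson finite_subset_image)
  have "\<And>\<F>. \<F> \<in> \<Phi> \<Longrightarrow> finite \<F> \<and> (\<forall>U\<in>\<F>. openin Y U)"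
    using \<Phi>(2) by (auto simp: \<Psi>_def)
  with \<Phi>(1) have "\<exists>\<G>. finite \<G> \<and> (\<forall>U\<in>\<G>. openin Y U) \<and>
    (\<forall>A. (\<exists>\<F>\<in>\<Phi>. \<forall>U\<in>\<F>. A \<inter> U \<noteq> {}) \<longleftrightarrow> (\<forall>U\<in>\<G>. A \<inter> U \<noteq> {}))"
    by (rule finite_Union_Inter_hit)
  then obtain \<G> where \<G>: "finite \<G>" "\<And>U. U \<in> \<G> \<Longrightarrow> openin Y U"
    and iff: "\<And>A. (\<exists>\<F>\<in>\<Phi>. \<forall>U\<in>\<F>. A \<inter> U \<noteq> {}) \<longleftrightarrow> (\<forall>U\<in>\<G>. A \<inter> U \<noteq> {})"
    by (elim exE conjE) (rule that; simp)
  show ?thesis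
  proof (rule that[OF \<G>])
    show "A \<inter> U \<noteq> {}" if "A \<in> \<K>" "U \<in> \<G>" for A U
    proof -
      have "\<exists>\<F>\<in>\<Phi>. \<forall>U\<in>\<F>. A \<inter> U \<noteq> {}"
        using \<C>(3) \<Phi>(3) that(1) by (auto simp: N_def)
      then show ?thesis
        using iff that(2) by blast
    qed
    show "{A. closedin Y A \<and> (\<forall>U\<in>\<G>. A \<inter> U \<noteq> {})} \<subseteq> W"
    proof clarify
      fix A assume "closedin Y A" "\<forall>U\<in>\<G>. A \<inter> U \<noteq> {}"
      then obtain \<F> where "\<F> \<in> \<Phi>" "A \<in> N \<F>"
        using iff[of A] unfolding N_def by blast
      then show "A \<in> W"
        using \<Phi>(2) unfolding \<Psi>_def by blast
    qed
  qed
qed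

text \<open>The specialization order of the lower Vietoris topology is inclusion: a larger closed
  set meets every open set that a smaller one meets, so it lies in all the same
  neighbourhoods.\<close>

lemma saturated_in_lower_vietoris_upward:
  assumes "compact_saturated_in (lower_vietoris Y) \<K>" "A \<in> \<K>" "A \<subseteq> B" "closedin Y B"
  shows "B \<in> \<K>"
proof -
  have "B \<in> W" if W: "openin (lower_vietoris Y) W" "\<K> \<subseteq> W" for W
  proof -
    have "A \<in> W"
      using W(2) assms(2) by blast
    then obtain \<F> where \<F>: "\<And>U. U \<in> \<F> \<Longrightarrow> A \<inter> U \<noteq> {}"
      "{B. closedin Y B \<and> (\<forall>U\<in>\<F>. B \<inter> U \<noteq> {})} \<subseteq> W"
      by (rule openin_lower_vietorisE[OF W(1)]) (rule that; simp)
    have "\<forall>U\<in>\<F>. B \<inter> U \<noteq> {}"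
      using \<F>(1) assms(3) by blast
    then show ?thesis
      using \<F>(2) assms(4) by blast
  qed
  moreover have "\<K> = \<Inter>{W. openin (lower_vietoris Y) W \<and> \<K> \<subseteq> W}"
    using assms(1) by (simp only: compact_saturated_in_def)
  ultimately show ?thesis
    by (metis (mono_tags, lifting) InterI mem_Collect_eq)
qed

lemma compact_saturated_in_lower_vietoris_closedin:
  "\<lbrakk>compact_saturated_in (lower_vietoris Y) \<K>; A \<in> \<K>\<rbrakk> \<Longrightarrow> closedin Y A"
  using compact_saturated_in_subset_topspace[of "lower_vietoris Y" \<K>]
  by (auto simp: topspace_lower_vietoris)

lemma closedin_upper_vietoris_compact_saturated_in:
  "\<lbrakk>closedin (upper_vietoris Y) \<A>; K \<in> \<A>\<rbrakk> \<Longrightarrow> compact_saturated_in Y K"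
  using closedin_subset[of "upper_vietoris Y" \<A>] by (auto simp: topspace_upper_vietoris)

text \<open>The complement of \<open>U\<close> is the largest closed set missing \<open>U\<close>.
  As \<open>\<K>\<close> is closed under larger closed sets, it contains some set missing
  \<open>U\<close> iff it contains this one.\<close>

lemma saturated_in_lower_vietoris_hit_iff:
  assumes "compact_saturated_in (lower_vietoris Y) \<K>" "openin Y U"
  shows "\<K> \<subseteq> {A. closedin Y A \<and> A \<inter> U \<noteq> {}} \<longleftrightarrow> topspace Y - U \<notin> \<K>"
proof -
  have "topspace Y - U \<in> \<K>" if "A \<in> \<K>" "A \<inter> U = {}" for A
  proof -
    have "A \<subseteq> topspace Y - U"
      using compact_saturated_in_lower_vietoris_closedin[OF assms(1) that(1)] that(2)
        closedin_subset by fastforce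
    then show ?thesis
      using saturated_in_lower_vietoris_upward[OF assms(1) that(1)] assms(2) by blast
  qed
  then show ?thesis
    using compact_saturated_in_lower_vietoris_closedin[OF assms(1)] by blast
qed

section \<open>Well-definedness of the two maps, and the composite of \<open>tau_map\<close> after
  \<open>sigma_map\<close>\<close>

lemma Compl_notin_sigma_map_iff:
  assumes "openin X U" "\<And>K. K \<in> \<A> \<Longrightarrow> K \<subseteq> topspace X"
  shows "topspace X - U \<notin> sigma_map X \<A> \<longleftrightarrow> (\<exists>K\<in>\<A>. K \<subseteq> U)"
proof -
  have "closedin X (topspace X - U)"
    using assms(1) by (simp add: openin_closedin_eq)
  moreover have "(topspace X - U) \<inter> K = {} \<longleftrightarrow> K \<subseteq> U" if "K \<in> \<A>" for K
    using assms(2)[OF that] by blast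
  ultimately show ?thesis
    by (simp add: sigma_map_def)
qed

text \<open>A subbasic cover forces some \<open>K\<close> in \<open>\<A>\<close> into the union of
  the open sets being hit. Finitely many of them cover \<open>K\<close>, and every member of
  \<open>sigma_map X \<A>\<close> meets \<open>K\<close>, hence one of these. Saturation follows by
  separating each closed set outside \<open>sigma_map X \<A>\<close> from it by a hit set.\<close>

lemma compact_saturated_in_sigma_map:
  assumes "closedin (upper_vietoris X) \<A>"
  shows "compact_saturated_in (lower_vietoris X) (sigma_map X \<A>)"
proof -
  have \<A>: "compact_saturated_in X K" "K \<subseteq> topspace X" if "K \<in> \<A>" for K
    using closedin_upper_vietoris_compact_saturated_in[OF assms that]
      compact_saturated_in_subset_topspace by blast+
  have "compactin (lower_vietoris X) (sigma_map X \<A>)"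
    unfolding lower_vietoris_def
  proof (rule compactin_topology_generated_by)
    let ?\<B> = "insert {A. closedin X A} {{A. closedin X A \<and> A \<inter> U \<noteq> {}} | U. openin X U}"
    show "sigma_map X \<A> \<subseteq> \<Union>?\<B>"
      by (auto simp: sigma_map_def)
    fix \<C> assume \<C>: "\<C> \<subseteq> ?\<B>" "sigma_map X \<A> \<subseteq> \<Union>\<C>"
    show "\<exists>\<C>'. finite \<C>' \<and> \<C>' \<subseteq> \<C> \<and> sigma_map X \<A> \<subseteq> \<Union>\<C>'"
    proof (cases "{A. closedin X A} \<in> \<C>")
      case True
      then show ?thesis
        by (intro exI[of _ "{{A. closedin X A}}"]) (auto simp: sigma_map_def)
    next
      case False
      let ?h = "\<lambda>U. {A. closedin X A \<and> A \<inter> U \<noteq> {}}"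
      let ?\<U> = "{U. openin X U \<and> ?h U \<in> \<C>}"
      have op: "openin X (\<Union>?\<U>)"
        by (rule openin_Union) auto
      \<comment> \<open>Since the carrier is not in \<open>\<C>\<close>, every covering set is a hit
        set of some member of \<open>?\<U>\<close>, which this complement misses.\<close>
      have "topspace X - \<Union>?\<U> \<notin> \<Union>\<C>"
        using \<C>(1) False by blast
      then obtain K where K: "K \<in> \<A>" "K \<subseteq> \<Union>?\<U>"
        using Compl_notin_sigma_map_iff[OF op, of \<A>] \<A>(2) \<C>(2) by blast
      then obtain \<F> where \<F>: "finite \<F>" "\<F> \<subseteq> ?\<U>" "K \<subseteq> \<Union>\<F>"
        using \<A>(1)[OF K(1)] compactinD[of X K ?\<U>] by (auto simp: compact_saturated_in_def)
      have "sigma_map X \<A> \<subseteq> \<Union>(?h ` \<F>)"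
        using K(1) \<F>(3) by (fastforce simp: sigma_map_def)
      then show ?thesis
        using \<F> by (intro exI[of _ "?h ` \<F>"]) auto
    qed
  qed
  moreover have "A \<in> sigma_map X \<A>"
    if A: "\<And>W. \<lbrakk>openin (lower_vietoris X) W; sigma_map X \<A> \<subseteq> W\<rbrakk> \<Longrightarrow> A \<in> W" for A
  proof -
    have cl: "closedin X A"
      using A[OF openin_topspace] by (auto simp: topspace_lower_vietoris sigma_map_def)
    have "A \<inter> K \<noteq> {}" if K: "K \<in> \<A>" for K
    proof
      assume "A \<inter> K = {}"
      \<comment> \<open>Now \<open>K\<close> lies in the complement of \<open>A\<close>, so whatever
        meets \<open>K\<close> hits that complement, whereas \<open>A\<close> itself does
        not.\<close>
      then have "sigma_map X \<A> \<subseteq> {B. closedin X B \<and> B \<inter> (topspace X - A) \<noteq> {}}"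
        using K \<A>(2) by (fastforce simp: sigma_map_def)
      then show False
        using A[OF openin_lower_vietoris_hit[of X "topspace X - A"]] cl by auto
    qed
    then show ?thesis
      using cl by (simp add: sigma_map_def)
  qed
  ultimately show ?thesis
    unfolding compact_saturated_in_def by blast
qed

text \<open>Failing to meet a closed \<open>A\<close> means lying in its open complement, so the
  complement of \<open>tau_map X \<K>\<close> is a union of boxes.\<close>

lemma closedin_tau_map:
  assumes "\<And>A. A \<in> \<K> \<Longrightarrow> closedin X A"
  shows "closedin (upper_vietoris X) (tau_map X \<K>)"
proof -
  have "K \<subseteq> topspace X - A \<longleftrightarrow> A \<inter> K = {}" if "compact_saturated_in X K" for A K
    using compact_saturated_in_subset_topspace[OF that] by blast
  then have "topspace (upper_vietoris X) - tau_map X \<K>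
      = \<Union>((\<lambda>A. {K. compact_saturated_in X K \<and> K \<subseteq> topspace X - A}) ` \<K>)"
    by (auto simp: topspace_upper_vietoris tau_map_def)
  moreover have "openin (upper_vietoris X) \<dots>"
    using assms by (intro openin_Union) (auto intro!: openin_upper_vietoris_subset)
  ultimately show ?thesis
    by (auto simp: closedin_def topspace_upper_vietoris tau_map_def)
qed

text \<open>A compact saturated set outside the closed \<open>\<A>\<close> has a box neighbourhood
  missing \<open>\<A>\<close>; the complement of the open set defining that box is then a member of
  \<open>sigma_map X \<A>\<close> that it fails to meet.\<close>

lemma tau_sigma_map:
  assumes "closedin (upper_vietoris X) \<A>"
  shows "tau_map X (sigma_map X \<A>) = \<A>"
proof
  have \<A>: "compact_saturated_in X K" "K \<subseteq> topspace X" if "K \<in> \<A>" for K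
    using closedin_upper_vietoris_compact_saturated_in[OF assms that]
      compact_saturated_in_subset_topspace by blast+
  show "\<A> \<subseteq> tau_map X (sigma_map X \<A>)"
    using \<A> by (auto simp: tau_map_def sigma_map_def)
  show "tau_map X (sigma_map X \<A>) \<subseteq> \<A>"
  proof (rule subsetI, rule ccontr)
    fix K assume K: "K \<in> tau_map X (sigma_map X \<A>)" "K \<notin> \<A>"
    have "openin (upper_vietoris X) (topspace (upper_vietoris X) - \<A>)"
      using assms by blast
    moreover have "K \<in> topspace (upper_vietoris X) - \<A>"
      using K by (simp add: tau_map_def topspace_upper_vietoris)
    ultimately obtain U where U: "openin X U" "K \<subseteq> U"
      "{L. compact_saturated_in X L \<and> L \<subseteq> U} \<subseteq> topspace (upper_vietoris X) - \<A>"
      by (rule openin_upper_vietorisE)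
    then have "topspace X - U \<in> sigma_map X \<A>"
      using Compl_notin_sigma_map_iff[OF U(1), of \<A>] \<A> by blast
    then show False
      using K(1) U(2) by (auto simp: tau_map_def)
  qed
qed

section \<open>Consonance and the composite of \<open>sigma_map\<close> after
  \<open>tau_map\<close>\<close>

text \<open>Membership of \<open>U\<close> says that all of \<open>\<K>\<close> hits
  \<open>U\<close>. Hit sets are monotone and preserve unions, so a directed union in the family
  yields a cover of \<open>\<K>\<close>; compactness and directedness reduce it to one
  member.\<close>

lemma scott_open_Compl_notin:
  assumes "compact_saturated_in (lower_vietoris X) \<K>"
  shows "scott_open X {U. openin X U \<and> topspace X - U \<notin> \<K>}"
  unfolding scott_open_def
proof (intro conjI allI impI)
  let ?\<H> = "{U. openin X U \<and> topspace X - U \<notin> \<K>}"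
  let ?h = "\<lambda>U. {A. closedin X A \<and> A \<inter> U \<noteq> {}}"
  note hit = saturated_in_lower_vietoris_hit_iff[OF assms]
  show "?\<H> \<subseteq> {U. openin X U}"
    by blast
  show "V \<in> ?\<H>" if "U \<in> ?\<H> \<and> openin X V \<and> U \<subseteq> V" for U V
    using that hit[of U] hit[of V] by fastforce
  fix \<D>
  assume "\<D> \<subseteq> {U. openin X U} \<and> \<D> \<noteq> {} \<and>
          (\<forall>U\<in>\<D>. \<forall>V\<in>\<D>. \<exists>W\<in>\<D>. U \<subseteq> W \<and> V \<subseteq> W) \<and> \<Union>\<D> \<in> ?\<H>"
  then have \<D>: "\<And>U. U \<in> \<D> \<Longrightarrow> openin X U" "\<D> \<noteq> {}"
    and dir: "\<And>U V. \<lbrakk>U \<in> \<D>; V \<in> \<D>\<rbrakk> \<Longrightarrow> \<exists>W\<in>\<D>. U \<subseteq> W \<and> V \<subseteq> W"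
    and Un: "openin X (\<Union>\<D>)" "topspace X - \<Union>\<D> \<notin> \<K>"
    by blast+
  have "\<K> \<subseteq> ?h (\<Union>\<D>)"
    using hit[OF Un(1)] Un(2) by blast
  then have sub: "\<K> \<subseteq> \<Union>(?h ` \<D>)"
    by blast
  have compact: "compactin (lower_vietoris X) \<K>"
    using assms by (simp add: compact_saturated_in_def)
  have opens: "openin (lower_vietoris X) V" if "V \<in> ?h ` \<D>" for V
    using that \<D>(1) openin_lower_vietoris_hit by auto
  have "\<exists>\<C>. finite \<C> \<and> \<C> \<subseteq> ?h ` \<D> \<and> \<K> \<subseteq> \<Union>\<C>"
    using compact opens sub by (rule compactinD)
  then obtain \<C> where \<C>: "finite \<C>" "\<C> \<subseteq> ?h ` \<D>" "\<K> \<subseteq> \<Union>\<C>"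
    by (elim exE conjE) (rule that)
  then obtain \<F> where \<F>: "finite \<F>" "\<F> \<subseteq> \<D>" "\<C> = ?h ` \<F>"
    by (meson finite_subset_image)
  \<comment> \<open>A finite part of a directed family has an upper bound in it; for an empty part,
    nonemptiness of \<open>\<D>\<close> supplies one.\<close>
  have "\<exists>W\<in>\<D>. \<forall>U\<in>\<F>. U \<subseteq> W"
    using \<F>(1,2)
  proof (induction \<F>)
    case empty
    then show ?case using \<D>(2) by blast
  next
    case (insert U \<F>)
    then obtain W where W: "W \<in> \<D>" "\<forall>U\<in>\<F>. U \<subseteq> W" by auto
    then obtain V where "V \<in> \<D>" "U \<subseteq> V" "W \<subseteq> V"
      using dir[of U W] insert.prems by auto
    then show ?case
      using W(2) by (intro bexI[of _ V]) auto
  qed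
  then obtain W where W: "W \<in> \<D>" "\<forall>U\<in>\<F>. U \<subseteq> W" by blast
  have "\<Union>\<C> \<subseteq> ?h W"
    unfolding \<F>(3) using W(2) by blast
  then have "\<K> \<subseteq> ?h W"
    using \<C>(3) by (rule order_trans[rotated])
  then have "W \<in> ?\<H>"
    using hit[OF \<D>(1)[OF W(1)]] \<D>(1)[OF W(1)] by simp
  then show "\<D> \<inter> ?\<H> \<noteq> {}"
    using W(1) by blast
qed

lemma sigma_tau_map:
  assumes "consonant X" and \<K>: "compact_saturated_in (lower_vietoris X) \<K>"
  shows "sigma_map X (tau_map X \<K>) = \<K>"
proof
  have cl: "closedin X A" if "A \<in> \<K>" for A
    using compact_saturated_in_lower_vietoris_closedin[OF \<K> that] .
  show "\<K> \<subseteq> sigma_map X (tau_map X \<K>)"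
    using cl by (auto simp: tau_map_def sigma_map_def)
  show "sigma_map X (tau_map X \<K>) \<subseteq> \<K>"
  proof (rule subsetI, rule ccontr)
    fix A assume A: "A \<in> sigma_map X (tau_map X \<K>)" "A \<notin> \<K>"
    let ?\<H> = "{U. openin X U \<and> topspace X - U \<notin> \<K>}"
    have "closedin X A"
      using A(1) by (simp add: sigma_map_def)
    then have "topspace X - A \<in> ?\<H>"
      using A(2) by (simp add: closedin_def double_diff)
    from assms(1)[unfolded consonant_def, rule_format, OF scott_open_Compl_notin[OF \<K>] this]
    obtain K where K: "compact_saturated_in X K" "topspace X - A \<in> open_supersets X K"
      "open_supersets X K \<subseteq> ?\<H>"
      by (elim exE conjE) (rule that)
    \<comment> \<open>Otherwise the complement of \<open>B\<close> would be an open neighbourhood of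
      \<open>K\<close>, hence in \<open>?\<H>\<close>, which says
      \<open>B \<notin> \<K>\<close>.\<close>
    have "B \<inter> K \<noteq> {}" if B: "B \<in> \<K>" for B
    proof
      assume "B \<inter> K = {}"
      then have "K \<subseteq> topspace X - B"
        using compact_saturated_in_subset_topspace[OF K(1)] by blast
      then have "topspace X - B \<in> open_supersets X K"
        using cl[OF B] by (simp add: open_supersets_def closedin_def)
      then have "topspace X - B \<in> ?\<H>"
        using K(3) by (rule rev_subsetD)
      then show False
        using B cl[OF B] by (simp add: closedin_def double_diff)
    qed
    then have "K \<in> tau_map X \<K>"
      using K(1) by (simp add: tau_map_def)
    then show False
      using A(1) K(2) by (auto simp: sigma_map_def open_supersets_def)
  qed
qed

section \<open>Continuity of the two maps\<close>

lemma continuous_map_sigma_map: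
  "continuous_map (lower_vietoris (upper_vietoris X)) (upper_vietoris (lower_vietoris X))
     (sigma_map X)"
  unfolding upper_vietoris_def[of "lower_vietoris X"]
proof (rule continuous_on_generated_topo)
  let ?S = "lower_vietoris (upper_vietoris X)"
  let ?B = "insert {\<K>. compact_saturated_in (lower_vietoris X) \<K>}
    {{\<K>. compact_saturated_in (lower_vietoris X) \<K> \<and> \<K> \<subseteq> W} | W. openin (lower_vietoris X) W}"
  have cs: "compact_saturated_in (lower_vietoris X) (sigma_map X \<A>)" if "\<A> \<in> topspace ?S" for \<A>
    using that by (simp add: topspace_lower_vietoris compact_saturated_in_sigma_map)
  then show "sigma_map X ` topspace ?S \<subseteq> \<Union>?B"
    by blast
  have op: "openin ?S {\<A> \<in> topspace ?S. sigma_map X \<A> \<subseteq> W}"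
    if W: "openin (lower_vietoris X) W" for W
  proof (subst openin_subopen, intro ballI)
    fix \<A> assume "\<A> \<in> {\<A> \<in> topspace ?S. sigma_map X \<A> \<subseteq> W}"
    then have \<A>: "\<A> \<in> topspace ?S" "sigma_map X \<A> \<subseteq> W" by auto
    have "compactin (lower_vietoris X) (sigma_map X \<A>)"
      using cs[OF \<A>(1)] by (simp add: compact_saturated_in_def)
    \<comment> \<open>Lying in \<open>W\<close> is replaced by the stronger demand of hitting each
      of finitely many open sets, which all members of \<open>sigma_map X \<A>\<close> still
      satisfy.\<close>
    then obtain \<G> where \<G>: "finite \<G>" "\<And>U. U \<in> \<G> \<Longrightarrow> openin X U"
      "\<And>A U. \<lbrakk>A \<in> sigma_map X \<A>; U \<in> \<G>\<rbrakk> \<Longrightarrow> A \<inter> U \<noteq> {}"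
      "{A. closedin X A \<and> (\<forall>U\<in>\<G>. A \<inter> U \<noteq> {})} \<subseteq> W"
      using compactin_lower_vietoris_basis[OF _ W \<A>(2)] by blast
    let ?box = "\<lambda>U. {K. compact_saturated_in X K \<and> K \<subseteq> U}"
    let ?N = "\<lambda>\<F>. {\<B> \<in> topspace ?S. \<forall>U\<in>\<F>. \<B> \<inter> ?box U \<noteq> {}}"
    have opN: "openin ?S (?N \<G>)"
      using \<G>(1,2)
    proof (induction \<G>)
      case empty
      then show ?case by simp
    next
      case (insert U \<F>)
      have "?N (insert U \<F>) = {\<B>. closedin (upper_vietoris X) \<B> \<and> \<B> \<inter> ?box U \<noteq> {}} \<inter> ?N \<F>"
        by (auto simp: topspace_lower_vietoris)
      moreover have "openin ?S {\<B>. closedin (upper_vietoris X) \<B> \<and> \<B> \<inter> ?box U \<noteq> {}}"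
        using insert.prems by (intro openin_lower_vietoris_hit openin_upper_vietoris_subset) auto
      ultimately show ?case
        using insert by (simp add: openin_Int)
    qed
    \<comment> \<open>Both conditions express that some \<open>K\<close> in \<open>\<B>\<close> lies
      in \<open>U\<close>. This turns the demands on \<open>sigma_map X \<B>\<close> into finitely
      many subbasic conditions on \<open>\<B>\<close>, whose conjunction \<open>?N \<G>\<close> is
      the required neighbourhood.\<close>
    have hit: "(\<exists>K\<in>\<B>. K \<subseteq> U) \<longleftrightarrow> \<B> \<inter> ?box U \<noteq> {}"
      "(\<exists>K\<in>\<B>. K \<subseteq> U) \<longleftrightarrow> sigma_map X \<B> \<subseteq> {A. closedin X A \<and> A \<inter> U \<noteq> {}}"
      if "\<B> \<in> topspace ?S" "U \<in> \<G>" for \<B> U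
    proof -
      have *: "compact_saturated_in X K" if "K \<in> \<B>" for K
        using that \<open>\<B> \<in> topspace ?S\<close> closedin_upper_vietoris_compact_saturated_in
        by (auto simp: topspace_lower_vietoris)
      then show "(\<exists>K\<in>\<B>. K \<subseteq> U) \<longleftrightarrow> \<B> \<inter> ?box U \<noteq> {}"
        by blast
      show "(\<exists>K\<in>\<B>. K \<subseteq> U) \<longleftrightarrow> sigma_map X \<B> \<subseteq> {A. closedin X A \<and> A \<inter> U \<noteq> {}}"
        using Compl_notin_sigma_map_iff[of X U \<B>] \<G>(2)[OF that(2)] * 
          compact_saturated_in_subset_topspace
          saturated_in_lower_vietoris_hit_iff[OF cs[OF that(1)], of U] by blast
    qed
    have "\<A> \<in> ?N \<G>"
    proof -
      have "\<A> \<inter> ?box U \<noteq> {}" if "U \<in> \<G>" for U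
      proof -
        have "sigma_map X \<A> \<subseteq> {A. closedin X A \<and> A \<inter> U \<noteq> {}}"
          using \<G>(3) that by (auto simp: sigma_map_def)
        then show ?thesis
          by (simp only: hit[OF \<A>(1) that, symmetric])
      qed
      then show ?thesis
        using \<A>(1) by simp
    qed
    moreover have "?N \<G> \<subseteq> {\<A> \<in> topspace ?S. sigma_map X \<A> \<subseteq> W}"
    proof clarify
      fix \<B> A assume \<B>: "\<B> \<in> topspace ?S" "\<forall>U\<in>\<G>. \<B> \<inter> ?box U \<noteq> {}" and A: "A \<in> sigma_map X \<B>"
      have "A \<inter> U \<noteq> {}" if "U \<in> \<G>" for U
      proof -
        have "\<B> \<inter> ?box U \<noteq> {}"
          using \<B>(2) that by (rule bspec)
        then have "sigma_map X \<B> \<subseteq> {A. closedin X A \<and> A \<inter> U \<noteq> {}}"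
          by (simp only: hit[OF \<B>(1) that, symmetric])
        then show ?thesis
          using A by blast
      qed
      moreover have "closedin X A"
        using A by (simp add: sigma_map_def)
      ultimately show "A \<in> W"
        using \<G>(4) by blast
    qed
    ultimately show "\<exists>T. openin ?S T \<and> \<A> \<in> T \<and> T \<subseteq> {\<A> \<in> topspace ?S. sigma_map X \<A> \<subseteq> W}"
      using opN by (intro exI[of _ "?N \<G>"] conjI)
  qed
  fix \<U> assume "\<U> \<in> ?B"
  then consider "\<U> = {\<K>. compact_saturated_in (lower_vietoris X) \<K>}"
    | W where "openin (lower_vietoris X) W"
        "\<U> = {\<K>. compact_saturated_in (lower_vietoris X) \<K> \<and> \<K> \<subseteq> W}"
    by blast
  then show "openin ?S (sigma_map X -` \<U> \<inter> topspace ?S)"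
  proof cases
    case 1
    then have "sigma_map X -` \<U> \<inter> topspace ?S = topspace ?S"
      using cs by blast
    then show ?thesis by simp
  next
    case 2
    then have "sigma_map X -` \<U> \<inter> topspace ?S = {\<A> \<in> topspace ?S. sigma_map X \<A> \<subseteq> W}"
      using cs by blast
    then show ?thesis using op[OF 2(1)] by simp
  qed
qed

text \<open>An open \<open>W\<close> is a union of boxes, so meeting \<open>W\<close> amounts to
  having a member below one of the corresponding open sets \<open>U\<close>. The identity
  \<open>sigma_tau_map\<close>, hence consonance, makes the existence of such a member of
  \<open>tau_map X \<L>\<close> a box condition on \<open>\<L>\<close>.\<close>

lemma continuous_map_tau_map:
  assumes "consonant X"
  shows "continuous_map (upper_vietoris (lower_vietoris X)) (lower_vietoris (upper_vietoris X))
     (tau_map X)"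
  unfolding lower_vietoris_def[of "upper_vietoris X"]
proof (rule continuous_on_generated_topo)
  let ?S = "upper_vietoris (lower_vietoris X)"
  let ?B = "insert {\<A>. closedin (upper_vietoris X) \<A>}
    {{\<A>. closedin (upper_vietoris X) \<A> \<and> \<A> \<inter> W \<noteq> {}} | W. openin (upper_vietoris X) W}"
  have cs: "compact_saturated_in (lower_vietoris X) \<K>" if "\<K> \<in> topspace ?S" for \<K>
    using that by (simp add: topspace_upper_vietoris)
  then have cl: "closedin (upper_vietoris X) (tau_map X \<K>)" if "\<K> \<in> topspace ?S" for \<K>
    using that by (intro closedin_tau_map) (metis compact_saturated_in_lower_vietoris_closedin)
  then show "tau_map X ` topspace ?S \<subseteq> \<Union>?B"
    by blast
  have op: "openin ?S {\<K> \<in> topspace ?S. tau_map X \<K> \<inter> W \<noteq> {}}"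
    if W: "openin (upper_vietoris X) W" for W
  proof (subst openin_subopen, intro ballI)
    fix \<K> assume "\<K> \<in> {\<K> \<in> topspace ?S. tau_map X \<K> \<inter> W \<noteq> {}}"
    then obtain K where \<K>: "\<K> \<in> topspace ?S" "K \<in> tau_map X \<K>" "K \<in> W" by blast
    then obtain U where U: "openin X U" "K \<subseteq> U" "{L. compact_saturated_in X L \<and> L \<subseteq> U} \<subseteq> W"
      using openin_upper_vietorisE[OF W] by blast
    let ?h = "{A. closedin X A \<and> A \<inter> U \<noteq> {}}"
    \<comment> \<open>The complement of \<open>U\<close> mediates: it is tested for membership in
      \<open>\<L>\<close> on one side and in \<open>sigma_map X (tau_map X \<L>)\<close> on the
      other, and these two families agree.\<close>
    have iff: "\<L> \<subseteq> ?h \<longleftrightarrow> (\<exists>L\<in>tau_map X \<L>. L \<subseteq> U)" if "\<L> \<in> topspace ?S" for \<L>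
    proof -
      have "\<L> \<subseteq> ?h \<longleftrightarrow> topspace X - U \<notin> sigma_map X (tau_map X \<L>)"
        using saturated_in_lower_vietoris_hit_iff[OF cs[OF that] U(1)]
          sigma_tau_map[OF assms cs[OF that]] by simp
      also have "\<dots> \<longleftrightarrow> (\<exists>L\<in>tau_map X \<L>. L \<subseteq> U)"
        using compact_saturated_in_subset_topspace
        by (intro Compl_notin_sigma_map_iff[OF U(1)]) (auto simp: tau_map_def)
      finally show ?thesis .
    qed
    have "openin ?S {\<L>. compact_saturated_in (lower_vietoris X) \<L> \<and> \<L> \<subseteq> ?h}"
      by (intro openin_upper_vietoris_subset openin_lower_vietoris_hit U(1))
    moreover have "\<K> \<in> {\<L>. compact_saturated_in (lower_vietoris X) \<L> \<and> \<L> \<subseteq> ?h}"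
      using iff[OF \<K>(1)] \<K>(2) U(2) cs[OF \<K>(1)] by blast
    moreover have "{\<L>. compact_saturated_in (lower_vietoris X) \<L> \<and> \<L> \<subseteq> ?h}
        \<subseteq> {\<K> \<in> topspace ?S. tau_map X \<K> \<inter> W \<noteq> {}}"
    proof
      fix \<L> assume "\<L> \<in> {\<L>. compact_saturated_in (lower_vietoris X) \<L> \<and> \<L> \<subseteq> ?h}"
      then have \<L>: "\<L> \<in> topspace ?S" "\<L> \<subseteq> ?h"
        by (auto simp: topspace_upper_vietoris)
      then obtain L where "L \<in> tau_map X \<L>" "L \<subseteq> U"
        using iff by blast
      moreover from this have "L \<in> W"
        using U(3) by (auto simp: tau_map_def)
      ultimately show "\<L> \<in> {\<K> \<in> topspace ?S. tau_map X \<K> \<inter> W \<noteq> {}}"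
        using \<L>(1) by blast
    qed
    ultimately show "\<exists>T. openin ?S T \<and> \<K> \<in> T \<and> T \<subseteq> {\<K> \<in> topspace ?S. tau_map X \<K> \<inter> W \<noteq> {}}"
      by (intro exI conjI)
  qed
  fix \<U> assume "\<U> \<in> ?B"
  then consider "\<U> = {\<A>. closedin (upper_vietoris X) \<A>}"
    | W where "openin (upper_vietoris X) W"
        "\<U> = {\<A>. closedin (upper_vietoris X) \<A> \<and> \<A> \<inter> W \<noteq> {}}"
    by blast
  then show "openin ?S (tau_map X -` \<U> \<inter> topspace ?S)"
  proof cases
    case 1
    then have "tau_map X -` \<U> \<inter> topspace ?S = topspace ?S"
      using cl by blast
    then show ?thesis by simp
  next
    case 2
    then have "tau_map X -` \<U> \<inter> topspace ?S = {\<K> \<in> topspace ?S. tau_map X \<K> \<inter> W \<noteq> {}}"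
      using cl by blast
    then show ?thesis using op[OF 2(1)] by simp
  qed
qed

theorem theorem6p14:
  fixes X :: "'a topology"
  assumes "consonant X"
  shows "homeomorphic_maps (lower_vietoris (upper_vietoris X)) (upper_vietoris (lower_vietoris X))
           (sigma_map X) (tau_map X)"
  unfolding homeomorphic_maps_def
  using continuous_map_sigma_map continuous_map_tau_map[OF assms] tau_sigma_map
    sigma_tau_map[OF assms]
  by (auto simp: topspace_lower_vietoris[of "upper_vietoris X"]
      topspace_upper_vietoris[of "lower_vietoris X"])

end
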